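(* Let $\mathcal I$ be a small step alternating pushdown system and let $\mathcal I_{\neg}$ and $\mathcal I'_{\neg}$ be as defined below. If $A$ is a configuration and $\neg A$ has a proof in $\mathcal I'_{\neg}$, then $\neg A$ has a co-inductive proof in $\mathcal I_{\neg}$.
   Context: Fix a language with finitely many unary predicate symbols (states), finitely many unary function symbols (stack symbols), a constant $\varepsilon$ and a variable $x$. Words are closed terms $\gamma_1(\cdots\gamma_n(\varepsilon))$; configurations are atomic propositions $P(w)$ with $P$ a state and $w$ a word. Besides atomic propositions we use formal negations $\neg A$. For an inference system $\mathcal J$ (rules with finitely many premises, each premise and the conclusion being an atomic proposition or its negation, possibly containing $x$), a proof of a closed proposition $C$ is a finite tree with root $C$ in which each node is labeled $\sigma B$ and its children $\sigma A_1,\dots,\sigma A_n$ for some rule $\frac{A_1\cdots A_n}{B}\in\mathcal J$ and substitution $\sigma$ of a word for $x$; a co-inductive proof is the same with possibly infinite trees. Rule types: an introduction rule is $\frac{P_1(x)\cdots P_n(x)}{Q(\gamma x)}$ ($\gamma$ a stack symbol, $n\ge0$) or $\frac{}{Q(\varepsilon)}$; an elimination rule is $\frac{P_1(\gamma x)\ P_2(x)\cdots P_n(x)}{Q(x)}$ ($n\ge1$); a neutral rule is $\frac{P_1(x)\cdots P_n(x)}{Q(x)}$ ($n\ge0$). A small step alternating pushdown system is a finite set of introduction, elimination and neutral rules; premises of rules are regarded as sets. Saturation: $\mathcal I_s$ is the smallest set of rules containing $\mathcal I$ and closed under (1) from an introduction rule $\frac{P_1(x)\cdots P_m(x)}{Q_1(\gamma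 x)}$ and an elimination rule $\frac{Q_1(\gamma x)\ Q_2(x)\cdots Q_n(x)}{R(x)}$, add $\frac{P_1(x)\cdots P_m(x)\ Q_2(x)\cdots Q_n(x)}{R(x)}$; (2) from introduction rules $\frac{P^i_1(x)\cdots P^i_{m_i}(x)}{Q_i(\gamma x)}$ ($i=1..n$, same $\gamma$) and a neutral rule $\frac{Q_1(x)\cdots Q_n(x)}{R(x)}$ ($n\ge0$), add $\frac{P^1_1(x)\cdots P^n_{m_n}(x)}{R(\gamma x)}$ (all premises together; for $n=0$, $\frac{}{R(\gamma x)}$ for every $\gamma$); (3) from introduction rules $\frac{}{Q_i(\varepsilon)}$ ($i=1..n$) and a neutral rule $\frac{Q_1(x)\cdots Q_n(x)}{R(x)}$ ($n\ge0$), add $\frac{}{R(\varepsilon)}$. $\mathcal I'$ is obtained from $\mathcal I_s$ by removing all elimination and neutral rules. For a small step system $\mathcal J$: $\tilde{\mathcal J}$ keeps the introduction rules of $\mathcal J$ and replaces each neutral or elimination rule (conclusion $P(x)$) by its instance with $x:=\varepsilon$ and its instances with $x:=\gamma x$ for every stack symbol $\gamma$; $\mathcal C$ is the set of all $P(\varepsilon)$, $P(\gamma x)$. Then $\mathcal J_{\neg}$ consists of the rules of $\mathcal J$ together with, for each $B\in\mathcal C$, letting $r_1,\dots,r_n$ ($n\ge0$) be the rules of $\tilde{\mathcal J}$ with conclusion $B$ and $A^i_1,\dots,A^i_{m_i}$ the premises of $r_i$, all rules $\frac{\neg A^1_{j_1}\ \cdots\ \neg A^n_{j_n}}{\neg B}$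 for $1\le j_i\le m_i$ (the single rule $\frac{}{\neg B}$ if $n=0$). $\mathcal I_{\neg}$ and $\mathcal I'_{\neg}$ are this construction applied to $\mathcal J=\mathcal I$ and $\mathcal J=\mathcal I'$ respectively. *)

theory Defs
  imports Main
begin

text \<open>
  The language is given by a set \<open>Q\<close> of states and a set \<open>G\<close> of stack symbols, which are
  explicit carrier sets (so \<open>G\<close> may be empty); they are assumed finite where this matters.
\<close>

datatype 'g trm = Eps | Var | App 'g "'g trm"

inductive_set words :: "'g set \<Rightarrow> 'g trm set" for G :: "'g set" where
  "Eps \<in> words G"
| "g \<in> G \<Longrightarrow> w \<in> words G \<Longrightarrow> App g w \<in> words G"

datatype ('p, 'g) atom = Atom 'p "'g trm"

datatype ('p, 'g) formula = Pos "('p, 'g) atom" | Neg "('p, 'g) atom"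

definition configurations :: "'p set \<Rightarrow> 'g set \<Rightarrow> ('p, 'g) atom set" where
  "configurations Q G = {Atom p w | p w. p \<in> Q \<and> w \<in> words G}"

primrec subst_trm :: "'g trm \<Rightarrow> 'g trm \<Rightarrow> 'g trm" where
  "subst_trm s Eps = Eps"
| "subst_trm s Var = s"
| "subst_trm s (App g t) = App g (subst_trm s t)"

primrec subst_atom :: "'g trm \<Rightarrow> ('p, 'g) atom \<Rightarrow> ('p, 'g) atom" where
  "subst_atom s (Atom p t) = Atom p (subst_trm s t)"

primrec subst_formula :: "'g trm \<Rightarrow> ('p, 'g) formula \<Rightarrow> ('p, 'g) formula" where
  "subst_formula s (Pos A) = Pos (subst_atom s A)"
| "subst_formula s (Neg A) = Neg (subst_atom s A)"

datatype 'a rule = Rule (prems: "'a set") (concl: 'a)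


subsection \<open>Proofs and co-inductive proofs\<close>

codatatype 'a tree = Node (root: 'a) (children: "'a tree list")

text \<open>Trees are finitely branching, so a tree is finite iff it is well-founded.\<close>

inductive finite_tree :: "'a tree \<Rightarrow> bool" where
  "(\<forall>t \<in> set ts. finite_tree t) \<Longrightarrow> finite_tree (Node a ts)"

text \<open>
  Every node of the tree is an instance of a rule of \<open>J\<close>. The premises of a rule form a set; the
  children of a node are the instances of these premises, each taken once, in some order.
\<close>

coinductive derivation :: "'g set \<Rightarrow> ('p, 'g) formula rule set \<Rightarrow> ('p, 'g) formula tree \<Rightarrow> bool"
  for G :: "'g set" and J :: "('p, 'g) formula rule set" where
  "\<lbrakk>r \<in> J; w \<in> words G; distinct Bs; set Bs = prems r;
    map root ts = map (subst_formula w) Bs; \<forall>t \<in> set ts. derivation G J t\<rbrakk>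
   \<Longrightarrow> derivation G J (Node (subst_formula w (concl r)) ts)"

definition has_proof :: "'g set \<Rightarrow> ('p, 'g) formula rule set \<Rightarrow> ('p, 'g) formula \<Rightarrow> bool" where
  "has_proof G J C \<longleftrightarrow> (\<exists>t. finite_tree t \<and> derivation G J t \<and> root t = C)"

definition has_coinductive_proof ::
    "'g set \<Rightarrow> ('p, 'g) formula rule set \<Rightarrow> ('p, 'g) formula \<Rightarrow> bool" where
  "has_coinductive_proof G J C \<longleftrightarrow> (\<exists>t. derivation G J t \<and> root t = C)"


subsection \<open>Small step alternating pushdown systems\<close>

definition var_atoms :: "'p set \<Rightarrow> ('p, 'g) atom set" where
  "var_atoms P = (\<lambda>p. Atom p Var) ` P"

definition intro_app_rule :: "'p set \<Rightarrow> 'p \<Rightarrow> 'g \<Rightarrow> ('p, 'g) atom rule" where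
  "intro_app_rule P q g = Rule (var_atoms P) (Atom q (App g Var))"

definition intro_eps_rule :: "'p \<Rightarrow> ('p, 'g) atom rule" where
  "intro_eps_rule q = Rule {} (Atom q Eps)"

definition elim_rule :: "'p \<Rightarrow> 'g \<Rightarrow> 'p set \<Rightarrow> 'p \<Rightarrow> ('p, 'g) atom rule" where
  "elim_rule p g P q = Rule (insert (Atom p (App g Var)) (var_atoms P)) (Atom q Var)"

definition neutral_rule :: "'p set \<Rightarrow> 'p \<Rightarrow> ('p, 'g) atom rule" where
  "neutral_rule P q = Rule (var_atoms P) (Atom q Var)"

definition intro_rules :: "'p set \<Rightarrow> 'g set \<Rightarrow> ('p, 'g) atom rule set" where
  "intro_rules Q G =
     {intro_app_rule P q g | P q g. P \<subseteq> Q \<and> q \<in> Q \<and> g \<in> G} \<union> {intro_eps_rule q | q. q \<in> Q}"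

definition elim_rules :: "'p set \<Rightarrow> 'g set \<Rightarrow> ('p, 'g) atom rule set" where
  "elim_rules Q G = {elim_rule p g P q | p g P q. p \<in> Q \<and> g \<in> G \<and> P \<subseteq> Q \<and> q \<in> Q}"

definition neutral_rules :: "'p set \<Rightarrow> ('p, 'g) atom rule set" where
  "neutral_rules Q = {neutral_rule P q | P q. P \<subseteq> Q \<and> q \<in> Q}"

definition small_step_apds :: "'p set \<Rightarrow> 'g set \<Rightarrow> ('p, 'g) atom rule set \<Rightarrow> bool" where
  "small_step_apds Q G I \<longleftrightarrow>
     finite I \<and> I \<subseteq> intro_rules Q G \<union> elim_rules Q G \<union> neutral_rules Q"


subsection \<open>Saturation\<close>

text \<open>
  In the last two closure rules, the set \<open>S\<close> of premises of the neutral rule may be empty; the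
  function \<open>P\<close> selects the premises of one introduction rule for each state in \<open>S\<close>.
\<close>

inductive_set saturation :: "'g set \<Rightarrow> ('p, 'g) atom rule set \<Rightarrow> ('p, 'g) atom rule set"
  for G :: "'g set" and I :: "('p, 'g) atom rule set" where
  base: "r \<in> I \<Longrightarrow> r \<in> saturation G I"
| cut_elim: "\<lbrakk>intro_app_rule P q g \<in> saturation G I; elim_rule q g S r \<in> saturation G I\<rbrakk>
    \<Longrightarrow> neutral_rule (P \<union> S) r \<in> saturation G I"
| cut_neutral_app: "\<lbrakk>g \<in> G; \<forall>q \<in> S. intro_app_rule (P q) q g \<in> saturation G I;
      neutral_rule S r \<in> saturation G I\<rbrakk>
    \<Longrightarrow> intro_app_rule (\<Union>q \<in> S. P q) r g \<in> saturation G I"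
| cut_neutral_eps: "\<lbrakk>\<forall>q \<in> S. intro_eps_rule q \<in> saturation G I;
      neutral_rule S r \<in> saturation G I\<rbrakk>
    \<Longrightarrow> intro_eps_rule r \<in> saturation G I"

definition saturated_intro_system ::
    "'p set \<Rightarrow> 'g set \<Rightarrow> ('p, 'g) atom rule set \<Rightarrow> ('p, 'g) atom rule set" where
  "saturated_intro_system Q G I = saturation G I - (elim_rules Q G \<union> neutral_rules Q)"


subsection \<open>Complementation\<close>

definition eps_app_terms :: "'g set \<Rightarrow> 'g trm set" where
  "eps_app_terms G = insert Eps ((\<lambda>g. App g Var) ` G)"

definition subst_rule :: "'g trm \<Rightarrow> ('p, 'g) atom rule \<Rightarrow> ('p, 'g) atom rule" where
  "subst_rule s r = Rule (subst_atom s ` prems r) (subst_atom s (concl r))"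

definition split_system ::
    "'p set \<Rightarrow> 'g set \<Rightarrow> ('p, 'g) atom rule set \<Rightarrow> ('p, 'g) atom rule set" where
  "split_system Q G J =
     (J \<inter> intro_rules Q G) \<union>
     {subst_rule s r | s r. s \<in> eps_app_terms G \<and> r \<in> J \<inter> (elim_rules Q G \<union> neutral_rules Q)}"

definition conclusions :: "'p set \<Rightarrow> 'g set \<Rightarrow> ('p, 'g) atom set" where
  "conclusions Q G = {Atom p t | p t. p \<in> Q \<and> t \<in> eps_app_terms G}"

text \<open>
  For each \<open>B\<close>, the function \<open>c\<close> selects one premise of every rule with conclusion \<open>B\<close>. If one of
  these rules has no premise, there is no such \<open>c\<close>.
\<close>

definition neg_rules :: "'p set \<Rightarrow> 'g set \<Rightarrow> ('p, 'g) atom rule set \<Rightarrow> ('p, 'g) formula rule set" where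
  "neg_rules Q G J =
     {Rule ((\<lambda>r. Neg (c r)) ` {r \<in> split_system Q G J. concl r = B}) (Neg B) | B c.
        B \<in> conclusions Q G \<and> (\<forall>r \<in> {r \<in> split_system Q G J. concl r = B}. c r \<in> prems r)}"

definition neg_system :: "'p set \<Rightarrow> 'g set \<Rightarrow> ('p, 'g) atom rule set \<Rightarrow> ('p, 'g) formula rule set" where
  "neg_system Q G J = {Rule (Pos ` prems r) (Pos (concl r)) | r. r \<in> J} \<union> neg_rules Q G J"

end

theory Submission
  imports Defs
begin

text \<open>
  A finite proof of \<open>\<not> A\<close> in the complementation of an introduction system shows that \<open>A\<close> is
  not provable there. The saturated introduction system proves every configuration that is
  provable in \<open>I\<close>: its provable configurations are closed under all saturated rules, because
  the last step of a proof is an introduction, which can be cut against an elimination or neutral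
  rule. Hence \<open>A\<close> is not provable in \<open>I\<close>, and the set of all unprovable configurations
  is a co-inductive refutation: every rule instance with an unprovable conclusion has an
  unprovable premise.
\<close>

section \<open>Provability of closed atoms, and substitution\<close>

text \<open>Provability of positive atoms without trees, so that rule induction and inversion apply
  directly.\<close>

inductive_set provable :: "'g set \<Rightarrow> ('p, 'g) atom rule set \<Rightarrow> ('p, 'g) atom set"
  for G :: "'g set" and J :: "('p, 'g) atom rule set" where
  rule: "\<lbrakk>r \<in> J; w \<in> words G; \<And>a. a \<in> prems r \<Longrightarrow> subst_atom w a \<in> provable G J\<rbrakk>
    \<Longrightarrow> subst_atom w (concl r) \<in> provable G J"

lemma subst_trm_subst_trm: "subst_trm w (subst_trm s t) = subst_trm (subst_trm w s) t"
  by (induction t) auto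

lemma subst_atom_subst_atom: "subst_atom w (subst_atom s a) = subst_atom (subst_trm w s) a"
  by (cases a) (simp add: subst_trm_subst_trm)

lemma subst_trm_in_words: "s \<in> eps_app_terms G \<Longrightarrow> w \<in> words G \<Longrightarrow> subst_trm w s \<in> words G"
  by (auto simp: eps_app_terms_def intro: words.intros)

lemma App_in_words_iff: "App g w \<in> words G \<longleftrightarrow> g \<in> G \<and> w \<in> words G"
  by (auto intro: words.intros elim: words.cases)

section \<open>Rule shapes and their parameters\<close>

lemma var_atoms_inject: "var_atoms P = var_atoms P' \<longleftrightarrow> P = P'"
  unfolding var_atoms_def by (rule inj_image_eq_iff) (auto simp: inj_def)

lemma App_notin_var_atoms: "Atom p (App g t) \<notin> var_atoms P"
  by (auto simp: var_atoms_def)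

lemma intro_app_rule_inject:
  "intro_app_rule P q g = intro_app_rule P' q' g' \<longleftrightarrow> P = P' \<and> q = q' \<and> g = g'"
  by (auto simp: intro_app_rule_def var_atoms_inject)

lemma neutral_rule_inject: "neutral_rule P q = neutral_rule P' q' \<longleftrightarrow> P = P' \<and> q = q'"
  by (auto simp: neutral_rule_def var_atoms_inject)

text \<open>The major premise is the only premise with a stack symbol, so it can be told apart from
  the others and removed.\<close>

lemma elim_rule_inject:
  "elim_rule p g P q = elim_rule p' g' P' q' \<longleftrightarrow> p = p' \<and> g = g' \<and> P = P' \<and> q = q'"
proof
  assume eq: "elim_rule p g P q = elim_rule p' g' P' q'"
  then have ins: "insert (Atom p (App g Var)) (var_atoms P)
      = insert (Atom p' (App g' Var)) (var_atoms P')"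
    by (simp add: elim_rule_def)
  then have pg: "p = p' \<and> g = g'"
    using App_notin_var_atoms[of p g Var P'] by (metis atom.inject insertE insertI1 trm.inject)
  then have "P = P'"
    using ins App_notin_var_atoms[of p g Var] by (simp add: insert_ident var_atoms_inject)
  then show "p = p' \<and> g = g' \<and> P = P' \<and> q = q'"
    using pg eq by (simp add: elim_rule_def)
qed auto

lemmas rule_form_defs = intro_app_rule_def intro_eps_rule_def elim_rule_def neutral_rule_def

text \<open>The three rule kinds are disjoint and a rule determines its parameters, so the carrier
  conditions can be read back from membership in the union.\<close>

lemma intro_app_rule_in_iff:
  "intro_app_rule P q g \<in> intro_rules Q G \<union> elim_rules Q G \<union> neutral_rules Q
    \<longleftrightarrow> P \<subseteq> Q \<and> q \<in> Q \<and> g \<in> G"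
proof -
  have "intro_app_rule P q g \<notin> elim_rules Q G \<union> neutral_rules Q"
    by (auto simp: elim_rules_def neutral_rules_def rule_form_defs)
  moreover have "intro_app_rule P q g \<noteq> intro_eps_rule q'" for q'
    by (simp add: rule_form_defs)
  ultimately show ?thesis
    unfolding intro_rules_def by (auto simp: intro_app_rule_inject)
qed

lemma neutral_rule_in_iff:
  fixes G :: "'g set"
  shows "neutral_rule P q \<in> intro_rules Q G \<union> elim_rules Q G \<union> neutral_rules Q \<longleftrightarrow> P \<subseteq> Q \<and> q \<in> Q"
proof -
  have "neutral_rule P q \<notin> intro_rules Q G"
    by (auto simp: intro_rules_def rule_form_defs)
  moreover have "neutral_rule P q \<noteq> elim_rule p g S r" for p S r and g :: 'g
    using App_notin_var_atoms by (metis elim_rule_def insertI1 neutral_rule_def rule.inject)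
  then have "neutral_rule P q \<notin> elim_rules Q G"
    by (auto simp: elim_rules_def)
  ultimately show ?thesis
    by (auto simp: neutral_rules_def neutral_rule_inject)
qed

lemma elim_rule_in_iff:
  "elim_rule p g P q \<in> intro_rules Q G \<union> elim_rules Q G \<union> neutral_rules Q
    \<longleftrightarrow> p \<in> Q \<and> g \<in> G \<and> P \<subseteq> Q \<and> q \<in> Q"
proof -
  have "elim_rule p g P q \<notin> intro_rules Q G"
    by (auto simp: intro_rules_def rule_form_defs)
  moreover have "elim_rule p g P q \<noteq> neutral_rule S r" for S r
    using App_notin_var_atoms by (metis elim_rule_def insertI1 neutral_rule_def rule.inject)
  then have "elim_rule p g P q \<notin> neutral_rules Q"
    by (auto simp: neutral_rules_def)
  ultimately show ?thesis
    by (auto simp: elim_rules_def elim_rule_inject)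
qed

section \<open>Saturation and its introduction part\<close>

text \<open>Each cut only recombines states and symbols of its parent rules.\<close>

lemma saturation_subset:
  assumes "I \<subseteq> intro_rules Q G \<union> elim_rules Q G \<union> neutral_rules Q"
  shows "saturation G I \<subseteq> intro_rules Q G \<union> elim_rules Q G \<union> neutral_rules Q"
proof
  fix r assume "r \<in> saturation G I"
  then show "r \<in> intro_rules Q G \<union> elim_rules Q G \<union> neutral_rules Q"
  proof induction
    case (base r)
    with assms show ?case
      by blast
  next
    case (cut_elim P q g S r)
    then show ?case
      unfolding neutral_rule_in_iff intro_app_rule_in_iff elim_rule_in_iff by blast
  next
    case (cut_neutral_eps S r)
    then show ?case
      unfolding neutral_rule_in_iff by (auto simp: intro_rules_def)
  next
    case (cut_neutral_app g S P r)
    then show ?case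
      unfolding neutral_rule_in_iff intro_app_rule_in_iff by blast
  qed
qed

lemma saturated_intro_system_subset:
  assumes "I \<subseteq> intro_rules Q G \<union> elim_rules Q G \<union> neutral_rules Q"
  shows "saturated_intro_system Q G I \<subseteq> intro_rules Q G"
  using saturation_subset[OF assms] by (auto simp: saturated_intro_system_def)

lemma intro_rule_in_saturated:
  "r \<in> saturation G I \<Longrightarrow> r \<in> intro_rules Q G \<Longrightarrow> r \<in> saturated_intro_system Q G I"
  by (auto simp: saturated_intro_system_def intro_rules_def elim_rules_def neutral_rules_def
      rule_form_defs)

section \<open>Inversion in introduction systems\<close>

text \<open>With introductions only, the top symbol of the word dictates the shape of the last rule
  and the substituted word.\<close>

lemma provable_AppE:
  assumes "Atom q (App g w) \<in> provable G J" and "J \<subseteq> intro_rules Q G"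
  obtains P where "intro_app_rule P q g \<in> J" "\<And>p. p \<in> P \<Longrightarrow> Atom p w \<in> provable G J"
  using assms(1)
proof (cases rule: provable.cases)
  case (rule r v)
  with assms(2) obtain P where P: "r = intro_app_rule P q g" "v = w"
    by (auto simp: intro_rules_def rule_form_defs)
  show thesis
  proof (rule that)
    show "intro_app_rule P q g \<in> J"
      using rule P by simp
    show "Atom p w \<in> provable G J" if "p \<in> P" for p
      using rule(4)[of "Atom p Var"] P that by (simp add: intro_app_rule_def var_atoms_def)
  qed
qed

lemma provable_EpsE:
  assumes "Atom q Eps \<in> provable G J" and "J \<subseteq> intro_rules Q G"
  shows "intro_eps_rule q \<in> J"
  using assms(1)
proof (cases rule: provable.cases)
  case (rule r v)
  with assms(2) show ?thesis
    by (auto simp: intro_rules_def rule_form_defs)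
qed

lemma provable_intro_app:
  assumes "intro_app_rule P q g \<in> J" "w \<in> words G" "\<And>p. p \<in> P \<Longrightarrow> Atom p w \<in> provable G J"
  shows "Atom q (App g w) \<in> provable G J"
  using provable.rule[OF assms(1,2)] assms(3) by (fastforce simp: intro_app_rule_def var_atoms_def)

lemma provable_intro_eps: "intro_eps_rule q \<in> J \<Longrightarrow> Atom q Eps \<in> provable G J"
  using provable.rule[of "intro_eps_rule q" J Eps G] by (auto simp: intro_eps_rule_def words.intros)

section \<open>Admissibility of neutral and elimination rules\<close>

text \<open>The premises all concern the same word, so their proofs end in introductions for the
  same symbol, or for \<open>Eps\<close>. Saturation has already merged these with the neutral rule
  into one introduction of \<open>r\<close>, which replaces the neutral step.\<close>

lemma saturated_neutral:
  assumes I: "I \<subseteq> intro_rules Q G \<union> elim_rules Q G \<union> neutral_rules Q"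
    and neutral: "neutral_rule S r \<in> saturation G I" and w: "w \<in> words G"
    and S: "\<And>q. q \<in> S \<Longrightarrow> Atom q w \<in> provable G (saturated_intro_system Q G I)"
  shows "Atom r w \<in> provable G (saturated_intro_system Q G I)"
  using w
proof (cases rule: words.cases)
  case 1
  have "\<forall>q\<in>S. intro_eps_rule q \<in> saturation G I"
  proof
    fix q assume "q \<in> S"
    with S 1 have "Atom q Eps \<in> provable G (saturated_intro_system Q G I)"
      by simp
    then have "intro_eps_rule q \<in> saturated_intro_system Q G I"
      by (rule provable_EpsE[OF _ saturated_intro_system_subset[OF I]])
    then show "intro_eps_rule q \<in> saturation G I"
      by (simp add: saturated_intro_system_def)
  qed
  then have "intro_eps_rule r \<in> saturation G I"
    using neutral by (rule saturation.cut_neutral_eps)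
  moreover have "r \<in> Q"
    using subsetD[OF saturation_subset[OF I] neutral] unfolding neutral_rule_in_iff by blast
  ultimately show ?thesis
    unfolding 1
    by (intro provable_intro_eps intro_rule_in_saturated) (auto simp: intro_rules_def)
next
  case (2 g v)
  have "\<forall>q\<in>S. \<exists>P. intro_app_rule P q g \<in> saturated_intro_system Q G I \<and>
      (\<forall>p\<in>P. Atom p v \<in> provable G (saturated_intro_system Q G I))"
  proof
    fix q assume "q \<in> S"
    with S 2(1) have "Atom q (App g v) \<in> provable G (saturated_intro_system Q G I)"
      by simp
    then show "\<exists>P. intro_app_rule P q g \<in> saturated_intro_system Q G I \<and>
      (\<forall>p\<in>P. Atom p v \<in> provable G (saturated_intro_system Q G I))"
      by (rule provable_AppE[OF _ saturated_intro_system_subset[OF I]]) blast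
  qed
  then obtain P where P: "\<And>q. q \<in> S \<Longrightarrow> intro_app_rule (P q) q g \<in> saturated_intro_system Q G I"
    "\<And>q p. q \<in> S \<Longrightarrow> p \<in> P q \<Longrightarrow> Atom p v \<in> provable G (saturated_intro_system Q G I)"
    by metis
  have cut: "intro_app_rule (\<Union>q\<in>S. P q) r g \<in> saturation G I"
    using 2 P neutral
    by (intro saturation.cut_neutral_app) (auto simp: saturated_intro_system_def)
  \<comment> \<open>The carrier conditions identify the merged rule as an introduction, hence as one
    that survives the removal of the other kinds.\<close>
  have "(\<Union>q\<in>S. P q) \<subseteq> Q \<and> r \<in> Q \<and> g \<in> G"
    using subsetD[OF saturation_subset[OF I] cut] by (simp only: intro_app_rule_in_iff)
  then have "intro_app_rule (\<Union>q\<in>S. P q) r g \<in> intro_rules Q G"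
    unfolding intro_rules_def by blast
  with cut have "intro_app_rule (\<Union>q\<in>S. P q) r g \<in> saturated_intro_system Q G I"
    by (rule intro_rule_in_saturated)
  then show ?thesis
    unfolding 2 using P 2 by (intro provable_intro_app) auto
qed

text \<open>Introductions of \<open>I\<close> are kept and neutral rules are admissible. An
  elimination is cut against the introduction that ends the proof of its major premise, which
  reduces it to a neutral rule.\<close>

lemma provable_subset_saturated:
  assumes I: "I \<subseteq> intro_rules Q G \<union> elim_rules Q G \<union> neutral_rules Q"
  shows "provable G I \<subseteq> provable G (saturated_intro_system Q G I)"
proof
  fix A assume "A \<in> provable G I"
  then show "A \<in> provable G (saturated_intro_system Q G I)"
  proof induction
    case (rule r w)
    have r: "r \<in> saturation G I"
      using rule by (simp add: saturation.base)
    consider "r \<in> intro_rules Q G" | p g P q where "r = elim_rule p g P q"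
      | P q where "r = neutral_rule P q"
      using rule.hyps(1) I unfolding elim_rules_def neutral_rules_def by blast
    then show ?case
    proof cases
      case 1
      show ?thesis
        using intro_rule_in_saturated[OF r 1] rule by (intro provable.rule)
    next
      case (2 p g P q)
      have major: "Atom p (App g w) \<in> provable G (saturated_intro_system Q G I)"
        and minor: "\<And>p'. p' \<in> P \<Longrightarrow> Atom p' w \<in> provable G (saturated_intro_system Q G I)"
        using rule.IH[of "Atom p (App g Var)"] rule.IH[of "Atom _ Var"] 2
        by (simp_all add: elim_rule_def var_atoms_def)
      obtain P' where P': "intro_app_rule P' p g \<in> saturated_intro_system Q G I"
        "\<And>p'. p' \<in> P' \<Longrightarrow> Atom p' w \<in> provable G (saturated_intro_system Q G I)"
        using provable_AppE[OF major saturated_intro_system_subset[OF I]] by blast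
      have "neutral_rule (P' \<union> P) q \<in> saturation G I"
        using P'(1) r 2 by (auto simp: saturated_intro_system_def intro: saturation.cut_elim)
      then have "Atom q w \<in> provable G (saturated_intro_system Q G I)"
        using saturated_neutral[OF I] minor P'(2) rule.hyps by blast
      then show ?thesis
        by (simp add: 2 elim_rule_def)
    next
      case (3 P q)
      have "Atom p w \<in> provable G (saturated_intro_system Q G I)" if "p \<in> P" for p
        using rule.IH[of "Atom p Var"] that 3 by (simp add: neutral_rule_def var_atoms_def)
      then have "Atom q w \<in> provable G (saturated_intro_system Q G I)"
        using saturated_neutral[OF I] r 3 rule.hyps by blast
      then show ?thesis
        by (simp add: 3 neutral_rule_def)
    qed
  qed
qed

section \<open>Soundness of finite refutations\<close>

text \<open>Induction on the refutation tree: for every rule that could conclude \<open>A\<close>,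
  some child refutes one of its premises. For introductions the splitting changes nothing, so these
  rules are the members of \<open>J\<close> themselves.\<close>

lemma neg_proof_sound:
  assumes J: "J \<subseteq> intro_rules Q G" and "has_proof G (neg_system Q G J) (Neg A)"
  shows "A \<notin> provable G J"
proof -
  have "A \<notin> provable G J"
    if "finite_tree t" "derivation G (neg_system Q G J) t" "root t = Neg A" for t A
    using that
  proof (induction arbitrary: A)
    case (1 ts a)
    from 1(2) obtain R w Bs where R: "R \<in> neg_system Q G J" "w \<in> words G" "set Bs = prems R"
      "map root ts = map (subst_formula w) Bs" "a = subst_formula w (concl R)"
      and ts: "\<forall>t\<in>set ts. derivation G (neg_system Q G J) t"
      by (cases rule: derivation.cases) auto
    \<comment> \<open>The root is negated, whereas the rules taken from \<open>J\<close> have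
      positive conclusions.\<close>
    have "R \<in> neg_rules Q G J"
      using R 1(3) by (auto simp: neg_system_def)
    then obtain B c where B: "R = Rule ((\<lambda>r. Neg (c r)) ` {r \<in> split_system Q G J. concl r = B}) (Neg B)"
      "B \<in> conclusions Q G" "\<And>r. r \<in> split_system Q G J \<Longrightarrow> concl r = B \<Longrightarrow> c r \<in> prems r"
      unfolding neg_rules_def by blast
    have A: "A = subst_atom w B"
      using R B 1(3) by simp
    have refuted: "subst_atom w (c r) \<notin> provable G J" if "r \<in> J" "concl r = B" for r
    proof -
      have "r \<in> split_system Q G J"
        using that J by (auto simp: split_system_def)
      then have "Neg (c r) \<in> set Bs"
        using that R B by auto
      then have "Neg (subst_atom w (c r)) \<in> set (map root ts)"
        using R(4) by force
      then show ?thesis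
        using 1(1) ts by auto
    qed
    show ?case
    proof
      assume "A \<in> provable G J"
      then show False
      proof (cases rule: provable.cases)
        case (rule r v)
        \<comment> \<open>Both terms are \<open>Eps\<close> or of the form \<open>App g Var\<close>;
          having the common instance \<open>A\<close>, they coincide.\<close>
        have concl: "concl r = B"
          using rule(1,2) A B(2) J
          by (auto simp: conclusions_def eps_app_terms_def intro_rules_def rule_form_defs)
        have "c r \<in> prems r"
          using concl rule J B(3) by (auto simp: split_system_def)
        \<comment> \<open>A conclusion with a stack symbol fixes the substituted word. A conclusion
          at \<open>Eps\<close> does not, but its rule has no premise, contrary to the choice of
          \<open>c r\<close>.\<close>
        moreover have "v = w"
          using rule(1,2) A B(2) J concl \<open>c r \<in> prems r\<close>
          by (auto simp: conclusions_def eps_app_terms_def intro_rules_def rule_form_defs)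
        ultimately show False
          using refuted rule concl by blast
      qed
    qed
  qed
  with assms(2) show ?thesis
    unfolding has_proof_def by blast
qed

section \<open>Co-inductive proofs from backward-closed sets\<close>

primcorec unfold_tree :: "('a \<Rightarrow> 'a list) \<Rightarrow> 'a \<Rightarrow> 'a tree" where
  "root (unfold_tree f a) = a"
| "children (unfold_tree f a) = map (unfold_tree f) (f a)"

text \<open>Fixing one rule instance for each member of \<open>X\<close> makes the children a
  function of the label, and unfolding this function gives the proof tree. Finiteness of the premise
  sets lets them be listed as children.\<close>

lemma has_coinductive_proof_coinduct:
  assumes "C \<in> X"
    and step: "\<And>C. C \<in> X \<Longrightarrow> \<exists>r\<in>J. \<exists>w\<in>words G. finite (prems r) \<and>
      C = subst_formula w (concl r) \<and> subst_formula w ` prems r \<subseteq> X"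
  shows "has_coinductive_proof G J C"
proof -
  have "\<forall>C\<in>X. \<exists>r w Bs. r \<in> J \<and> w \<in> words G \<and> distinct Bs \<and> set Bs = prems r \<and>
      C = subst_formula w (concl r) \<and> subst_formula w ` prems r \<subseteq> X"
    using step finite_distinct_list by metis
  then obtain r w Bs where choice: "\<And>C. C \<in> X \<Longrightarrow> r C \<in> J \<and> w C \<in> words G \<and> distinct (Bs C) \<and>
      set (Bs C) = prems (r C) \<and> C = subst_formula (w C) (concl (r C)) \<and>
      subst_formula (w C) ` prems (r C) \<subseteq> X"
    by metis
  define f where "f C = map (subst_formula (w C)) (Bs C)" for C
  have "derivation G J t" if "\<exists>C\<in>X. t = unfold_tree f C" for t
    using that
  proof (coinduction arbitrary: t)
    case derivation
    then obtain C where C: "C \<in> X" "t = unfold_tree f C"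
      by blast
    have "t = Node C (map (unfold_tree f) (f C))"
      using C by (simp add: unfold_tree.code)
    moreover have "map root (map (unfold_tree f) (f C)) = map (subst_formula (w C)) (Bs C)"
      by (simp add: f_def)
    moreover have "set (f C) \<subseteq> X"
      using choice[OF C(1)] by (auto simp: f_def)
    ultimately show ?case
      using choice[OF C(1)]
      by (intro exI[of _ "r C"] exI[of _ "w C"] exI[of _ "Bs C"]
          exI[of _ "map (unfold_tree f) (f C)"]) auto
  qed
  then show ?thesis
    using assms(1) unfolding has_coinductive_proof_def by (metis unfold_tree.simps(1))
qed

section \<open>Co-inductive refutation of unprovable configurations\<close>

text \<open>Ensures that each negated rule has finitely many premises.\<close>

lemma finite_split_system:
  assumes "finite G" "finite J"
  shows "finite (split_system Q G J)"
proof -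
  have "{subst_rule s r | s r. s \<in> eps_app_terms G \<and> r \<in> J \<inter> (elim_rules Q G \<union> neutral_rules Q)}
      \<subseteq> (\<lambda>(s, r). subst_rule s r) ` (eps_app_terms G \<times> J)"
    by auto
  moreover have "finite (eps_app_terms G)"
    using assms by (simp add: eps_app_terms_def)
  ultimately show ?thesis
    unfolding split_system_def using assms by (meson finite_Int finite_SigmaI finite_UnI
        finite_imageI finite_subset)
qed

text \<open>Keeps the refutation within configurations, as \<open>neg_rules\<close> only covers
  states in \<open>Q\<close>.\<close>

lemma prems_configurations:
  assumes "r \<in> intro_rules Q G \<union> elim_rules Q G \<union> neutral_rules Q" "w \<in> words G" "a \<in> prems r"
  shows "subst_atom w a \<in> configurations Q G"
  using assms
  by (auto simp: intro_rules_def elim_rules_def neutral_rules_def rule_form_defs var_atoms_def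
      configurations_def App_in_words_iff subset_iff)

text \<open>A split rule is a rule of \<open>J\<close> under a substitution, so composing the two
  substitutions gives an instance of the original rule.\<close>

lemma split_system_instance:
  assumes "r \<in> split_system Q G J" "w \<in> words G"
  obtains r' w' where "r' \<in> J" "w' \<in> words G" "r' \<in> intro_rules Q G \<union> elim_rules Q G \<union> neutral_rules Q"
    "subst_atom w (concl r) = subst_atom w' (concl r')"
    "subst_atom w ` prems r = subst_atom w' ` prems r'"
proof (cases "r \<in> J \<inter> intro_rules Q G")
  case True
  with assms that show thesis
    by blast
next
  case False
  with assms obtain s r' where "r = subst_rule s r'" "s \<in> eps_app_terms G" "r' \<in> J"
    "r' \<in> elim_rules Q G \<union> neutral_rules Q"
    unfolding split_system_def by blast
  with assms that[of r' "subst_trm w s"] show thesis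
    by (auto simp: subst_rule_def subst_atom_subst_atom subst_trm_in_words image_image)
qed

lemma unprovable_coinductive:
  fixes Q :: "'p set" and G :: "'g set"
  assumes fin: "finite G" "finite J" and A: "A \<in> configurations Q G" "A \<notin> provable G J"
  shows "has_coinductive_proof G (neg_system Q G J) (Neg A)"
proof (rule has_coinductive_proof_coinduct)
  show "Neg A \<in> Neg ` (configurations Q G - provable G J)"
    using A by blast
next
  fix C :: "('p, 'g) formula"
  assume "C \<in> Neg ` (configurations Q G - provable G J)"
  then obtain p u where C: "C = Neg (Atom p u)" "p \<in> Q" "u \<in> words G" "Atom p u \<notin> provable G J"
    by (auto simp: configurations_def)
  \<comment> \<open>Every word matches one of the terms of \<open>eps_app_terms\<close>, so some
    negated rules apply to it. For the empty word, \<open>w\<close> defaults to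
    \<open>Eps\<close>.\<close>
  obtain t w where t: "t \<in> eps_app_terms G" "w \<in> words G" "u = subst_trm w t"
    using C(3)
  proof (cases rule: words.cases)
    case 1
    then show thesis
      using that[of Eps Eps] by (simp add: eps_app_terms_def words.intros)
  next
    case (2 g v)
    then show thesis
      using that[of "App g Var" v] by (simp add: eps_app_terms_def)
  qed
  define B where "B = Atom p t"
  define R where "R = {r \<in> split_system Q G J. concl r = B}"
  have "\<exists>a\<in>prems r. subst_atom w a \<in> configurations Q G - provable G J" if "r \<in> R" for r
  proof -
    from that have r: "r \<in> split_system Q G J" "concl r = B"
      by (auto simp: R_def)
    obtain r' w' where r': "r' \<in> J" "w' \<in> words G"
      "r' \<in> intro_rules Q G \<union> elim_rules Q G \<union> neutral_rules Q"
      "subst_atom w (concl r) = subst_atom w' (concl r')"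
      "subst_atom w ` prems r = subst_atom w' ` prems r'"
      using split_system_instance[OF r(1) t(2)] by blast
    have "subst_atom w' (concl r') \<notin> provable G J"
      using C(4) t(3) r(2) r'(4) by (simp add: B_def)
    \<comment> \<open>Were all premises of the instance provable, so would be its
      conclusion.\<close>
    then obtain a where "a \<in> prems r'" "subst_atom w' a \<notin> provable G J"
      using provable.rule[OF r'(1,2)] by blast
    then have "subst_atom w' a \<in> subst_atom w ` prems r"
      "subst_atom w' a \<in> configurations Q G - provable G J"
      using r'(5) prems_configurations[OF r'(3,2)] by auto
    then show ?thesis
      by auto
  qed
  \<comment> \<open>Choosing an unprovable premise in each rule yields the selector that
    \<open>neg_rules\<close> asks for.\<close>
  then obtain c where c: "\<And>r. r \<in> R \<Longrightarrow> c r \<in> prems r"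
    "\<And>r. r \<in> R \<Longrightarrow> subst_atom w (c r) \<in> configurations Q G - provable G J"
    by metis
  have "Rule ((\<lambda>r. Neg (c r)) ` R) (Neg B) \<in> neg_rules Q G J"
    using c(1) C(2) t(1) unfolding neg_rules_def R_def conclusions_def B_def by blast
  moreover have "finite R"
    using finite_split_system[OF fin] by (simp add: R_def)
  ultimately show "\<exists>r\<in>neg_system Q G J. \<exists>w\<in>words G. finite (prems r) \<and>
      C = subst_formula w (concl r) \<and>
      subst_formula w ` prems r \<subseteq> Neg ` (configurations Q G - provable G J)"
    using c(2) C(1) t
    by (intro bexI[of _ "Rule ((\<lambda>r. Neg (c r)) ` R) (Neg B)"] bexI[of _ w])
      (auto simp: neg_system_def B_def)
qed

theorem theorem4:
  fixes Q :: "'p set" and G :: "'g set"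
    and I :: "('p, 'g) atom rule set" and A :: "('p, 'g) atom"
  assumes "finite Q" and "finite G"
    and "small_step_apds Q G I"
    and "A \<in> configurations Q G"
    and "has_proof G (neg_system Q G (saturated_intro_system Q G I)) (Neg A)"
  shows "has_coinductive_proof G (neg_system Q G I) (Neg A)"
proof -
  have I: "finite I" "I \<subseteq> intro_rules Q G \<union> elim_rules Q G \<union> neutral_rules Q"
    using assms(3) by (auto simp: small_step_apds_def)
  have "A \<notin> provable G (saturated_intro_system Q G I)"
    using neg_proof_sound[OF saturated_intro_system_subset[OF I(2)] assms(5)] .
  then have "A \<notin> provable G I"
    using provable_subset_saturated[OF I(2)] by blast
  then show ?thesis
    using unprovable_coinductive assms(2,4) I(1) by blast
qed

end
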